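(* Let $a,b,c,d,\alpha,\beta$ be positive real numbers such that $a\leq c$, $b\leq d$, $\beta d\leq \alpha b$, and such that for all $t\in[0,\infty)$ we have $a+bt\leq c+dt$, $\psi(a+bt)>0$ and $\psi(c+dt)>0$. Define $$U(t)=\frac{[\psi(a+bt)]^{\alpha}}{[\psi(c+dt)]^{\beta}},\qquad t\in[0,\infty).$$ Then $U$ is non-decreasing on $[0,\infty)$, and for every $t\in[0,1]$, $$\frac{[\psi(a)]^{\alpha}}{[\psi(c)]^{\beta}}\leq\frac{[\psi(a+bt)]^{\alpha}}{[\psi(c+dt)]^{\beta}}\leq\frac{[\psi(a+b)]^{\alpha}}{[\psi(c+d)]^{\beta}}.$$
   Context: For $t>0$, $\Gamma(t)=\int_0^\infty e^{-x}x^{t-1}\,dx$ is the classical Gamma function and $\psi(t)=\frac{d}{dt}\ln\Gamma(t)=\Gamma'(t)/\Gamma(t)$ is the psi (digamma) function. *)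

theory Defs
  imports "HOL-Analysis.Analysis"
begin

text \<open>
  The psi function is the library's \<^term>\<open>Digamma\<close>, which is introduced there through a
  series; on the positive reals it is the logarithmic derivative of \<^term>\<open>Gamma\<close>:
\<close>

lemma deriv_ln_Gamma_eq_Digamma:
  fixes t :: real
  assumes "t > 0"
  shows "deriv (\<lambda>x. ln (Gamma x)) t = Digamma t"
    and "deriv Gamma t / Gamma t = Digamma t"
proof -
  have G: "(Gamma has_field_derivative Gamma t * Digamma t) (at t)"
    using assms by (intro has_field_derivative_Gamma) (auto elim!: nonpos_Ints_cases)
  have pos: "Gamma t > 0"
    using assms by (rule Gamma_real_pos)
  have "((\<lambda>x. ln (Gamma x)) has_field_derivative Digamma t) (at t)"
    using pos by (auto intro!: DERIV_chain2[OF DERIV_ln_divide G, THEN DERIV_cong])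
  then show "deriv (\<lambda>x. ln (Gamma x)) t = Digamma t"
    by (rule DERIV_imp_deriv)
  show "deriv Gamma t / Gamma t = Digamma t"
    using DERIV_imp_deriv[OF G] pos by simp
qed

definition digamma_ratio :: "real \<Rightarrow> real \<Rightarrow> real \<Rightarrow> real \<Rightarrow> real \<Rightarrow> real \<Rightarrow> real \<Rightarrow> real" where
  "digamma_ratio a b c d \<alpha> \<beta> t = Digamma (a + b * t) powr \<alpha> / Digamma (c + d * t) powr \<beta>"

end

theory Submission
  imports Defs
begin

text \<open>
  The logarithmic derivative of $U$ is
  $\alpha b \psi'(a+bt)/\psi(a+bt) - \beta d \psi'(c+dt)/\psi(c+dt)$. Since $\psi$ is increasing
  and $\psi'$ is positive and decreasing, $\psi'/\psi$ is decreasing wherever $\psi$ is positive.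
  Together with $a+bt \le c+dt$ and $\beta d \le \alpha b$ this makes the difference nonnegative.
\<close>

lemma Trigamma_real_pos: "x > 0 \<Longrightarrow> Polygamma 1 (x::real) > 0"
  by (rule Polygamma_real_odd_pos) (auto elim!: nonpos_Ints_cases)

text \<open>Moving from \<open>x\<close> to \<open>y\<close> shrinks the positive numerator and
  enlarges the denominator. Positivity of \<open>Digamma\<close> at the left point suffices, because
  monotonicity carries it to \<open>y\<close>.\<close>

lemma Trigamma_over_Digamma_antimono:
  fixes x y :: real
  assumes "0 < x" "x \<le> y" "Digamma x > 0"
  shows "Polygamma 1 y / Digamma y \<le> Polygamma 1 x / Digamma x"
proof (rule frac_le)
  show "0 \<le> Polygamma 1 x"
    using Trigamma_real_pos[OF assms(1)] by simp
  show "Polygamma 1 y \<le> Polygamma 1 x"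
    \<comment> \<open>The library fact compares distinct points only, so \<open>x = y\<close> is
      split off.\<close>
    using assms Polygamma_real_strict_antimono[of x y 1] by (cases "x = y") simp_all
  show "Digamma x \<le> Digamma y"
    using assms by (simp add: Digamma_real_mono)
qed (use assms in simp)

text \<open>Chain rule, with \<open>Polygamma 1\<close> as the derivative of \<open>Digamma\<close>.
  The inner slope \<open>q\<close> is kept as a separate factor so that the remaining quotient is
  the one known to be antitone.\<close>

lemma has_real_derivative_ln_Digamma_linear:
  fixes p q t :: real
  assumes "p + q * t > 0" "Digamma (p + q * t) > 0"
  shows "((\<lambda>t. ln (Digamma (p + q * t))) has_real_derivative
    q * (Polygamma 1 (p + q * t) / Digamma (p + q * t))) (at t)"
  using assms by (auto intro!: derivative_eq_intros elim!: nonpos_Ints_cases)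

text \<open>Positive bases rule out the default \<open>0 powr x = 0\<close>, so both powers unfold
  to exponentials. Monotonicity of the ratio then reduces to that of the exponent.\<close>

lemma digamma_ratio_eq_exp:
  assumes "Digamma (a + b * t) > 0" "Digamma (c + d * t) > 0"
  shows "digamma_ratio a b c d \<alpha> \<beta> t =
    exp (\<alpha> * ln (Digamma (a + b * t)) - \<beta> * ln (Digamma (c + d * t)))"
  using assms by (simp add: digamma_ratio_def powr_def exp_diff)

lemma mono_on_digamma_ratio:
  fixes a b c d \<alpha> \<beta> :: real
  assumes a: "a > 0" and c: "c > 0" and b: "b \<ge> 0" and d: "d \<ge> 0" and \<beta>: "\<beta> \<ge> 0"
    and coeffs: "\<beta> * d \<le> \<alpha> * b"
    and le: "\<And>t. t \<ge> 0 \<Longrightarrow> a + b * t \<le> c + d * t"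
    and pos1: "\<And>t. t \<ge> 0 \<Longrightarrow> Digamma (a + b * t) > 0"
    and pos2: "\<And>t. t \<ge> 0 \<Longrightarrow> Digamma (c + d * t) > 0"
  shows "mono_on {0..} (digamma_ratio a b c d \<alpha> \<beta>)"
proof (rule mono_onI)
  fix r s :: real
  assume r: "r \<in> {0..}" and s: "s \<in> {0..}" and "r \<le> s"
  \<comment> \<open>\<open>g\<close> is the logarithm of the ratio, and \<rho> below is the
    logarithmic derivative of \<open>Digamma\<close>.\<close>
  define g where "g t = \<alpha> * ln (Digamma (a + b * t)) - \<beta> * ln (Digamma (c + d * t))" for t
  define \<rho> :: "real \<Rightarrow> real" where "\<rho> x = Polygamma 1 x / Digamma x" for x
  have "g r \<le> g s"
  proof (rule DERIV_nonneg_imp_nondecreasing[OF \<open>r \<le> s\<close>])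
    fix t assume "r \<le> t" "t \<le> s"
    then have t: "t \<ge> 0" using r by simp
    have x: "a + b * t > 0" and y: "c + d * t > 0"
      using a b c d t by (simp_all add: add_pos_nonneg)
    have "(g has_real_derivative
        \<alpha> * (b * \<rho> (a + b * t)) - \<beta> * (d * \<rho> (c + d * t))) (at t)"
      unfolding g_def \<rho>_def
      by (intro DERIV_diff DERIV_cmult has_real_derivative_ln_Digamma_linear x y pos1 pos2 t)
    moreover have "\<beta> * (d * \<rho> (c + d * t)) \<le> \<alpha> * (b * \<rho> (a + b * t))"
    proof -
      have \<rho>_le: "\<rho> (c + d * t) \<le> \<rho> (a + b * t)"
        unfolding \<rho>_def by (rule Trigamma_over_Digamma_antimono[OF x le[OF t] pos1[OF t]])
      have "0 \<le> Polygamma 1 (c + d * t)"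
        using Trigamma_real_pos[OF y] by simp
      then have \<rho>_nonneg: "0 \<le> \<rho> (c + d * t)"
        unfolding \<rho>_def using pos2[OF t] by simp
      \<comment> \<open>Multiplying the two inequalities needs 0 \<le> \<alpha> * b, which follows
        from this bound and \<open>coeffs\<close>.\<close>
      have "0 \<le> \<beta> * d" using \<beta> d by simp
      then have "(\<beta> * d) * \<rho> (c + d * t) \<le> (\<alpha> * b) * \<rho> (a + b * t)"
        by (intro mult_mono coeffs \<rho>_le \<rho>_nonneg) (use coeffs in linarith)
      then show ?thesis by (simp add: mult.assoc)
    qed
    ultimately show "\<exists>y. (g has_real_derivative y) (at t) \<and> 0 \<le> y"
      by auto
  qed
  then show "digamma_ratio a b c d \<alpha> \<beta> r \<le> digamma_ratio a b c d \<alpha> \<beta> s"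
    using r s by (simp add: digamma_ratio_eq_exp pos1 pos2 g_def)
qed

theorem theorem2p3:
  fixes a b c d \<alpha> \<beta> :: real
  assumes "a > 0" and "b > 0" and "c > 0" and "d > 0" and "\<alpha> > 0" and "\<beta> > 0"
    and "a \<le> c" and "b \<le> d" and "\<beta> * d \<le> \<alpha> * b"
    and "\<And>t. t \<ge> 0 \<Longrightarrow> a + b * t \<le> c + d * t"
    and "\<And>t. t \<ge> 0 \<Longrightarrow> Digamma (a + b * t) > 0"
    and "\<And>t. t \<ge> 0 \<Longrightarrow> Digamma (c + d * t) > 0"
  shows "mono_on {0..} (digamma_ratio a b c d \<alpha> \<beta>) \<and>
    (\<forall>t\<in>{0..1}.
       Digamma a powr \<alpha> / Digamma c powr \<beta>
         \<le> Digamma (a + b * t) powr \<alpha> / Digamma (c + d * t) powr \<beta> \<and>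
       Digamma (a + b * t) powr \<alpha> / Digamma (c + d * t) powr \<beta>
         \<le> Digamma (a + b) powr \<alpha> / Digamma (c + d) powr \<beta>)"
proof (intro conjI ballI)
  show mono: "mono_on {0..} (digamma_ratio a b c d \<alpha> \<beta>)"
    using assms by (intro mono_on_digamma_ratio) simp_all
  fix t :: real
  assume t: "t \<in> {0..1}"
  show "Digamma a powr \<alpha> / Digamma c powr \<beta>
      \<le> Digamma (a + b * t) powr \<alpha> / Digamma (c + d * t) powr \<beta>"
    \<comment> \<open>The two bounds are monotonicity between \<open>t\<close> and the endpoints 0
      and 1, where the linear arguments become \<open>a\<close>, \<open>c\<close> and
      \<open>a + b\<close>, \<open>c + d\<close>.\<close>
    using mono_onD[OF mono, of 0 t] t by (simp add: digamma_ratio_def)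
  show "Digamma (a + b * t) powr \<alpha> / Digamma (c + d * t) powr \<beta>
      \<le> Digamma (a + b) powr \<alpha> / Digamma (c + d) powr \<beta>"
    using mono_onD[OF mono, of t 1] t by (simp add: digamma_ratio_def)
qed

end
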